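(* Let $c\in\mathbb{R}$ with $c\geq 1$ and let $k\in\mathbb{N}=\{0,1,2,\dots\}$. Let $G$ be a graph that is $c$-quasi-isometric to a graph $H$ of pathwidth at most $k$. Then $G$ admits a proper partition $\mathcal{P}$ such that the quotient $G/\mathcal{P}$ has pathwidth at most $k$ and every part of $\mathcal{P}$ has weak diameter in $G$ at most $4(k+1)c^2+c$.
   Context: For $c\geq 1$, a map $\phi:V(G)\to V(H)$ is a $c$-quasi-isometry from $G$ to $H$ if (1) for all distinct $u,v\in V(G)$, $\operatorname{dist}_G(u,v)\leq c\,\operatorname{dist}_H(\phi(u),\phi(v))+c$ and $\operatorname{dist}_H(\phi(u),\phi(v))\leq c\,\operatorname{dist}_G(u,v)+c$; and (2) for each $h\in V(H)$ there is $v\in V(G)$ with $\operatorname{dist}_H(h,\phi(v))\leq c$. $G$ is $c$-quasi-isometric to $H$ if such a map exists. A partition $\mathcal{P}$ of $G$ is a collection of pairwise disjoint subsets (parts) of $V(G)$ whose union is $V(G)$; it is proper if every part is nonempty. The quotient $G/\mathcal{P}$ is the simple graph with vertex set $\mathcal{P}$ in which distinct parts $P_1,P_2$ are adjacent iff there is an edge $uv\in E(G)$ with $u\in P_1$, $v\in P_2$. The weak diameter in $G$ of a set $S\subseteq V(G)$ is the maximum of $\operatorname{dist}_G(u,v)$ over $u,v\in S$ (distances measured in $G$). Parts need not induce connected subgraphs. *)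

theory Defs
  imports "HOL-Library.Extended_Real" "HOL-Library.Disjoint_Sets"
begin

text \<open>The vertex set may be empty or infinite.\<close>

record 'a ugraph =
  verts :: "'a set"
  edges :: "'a set set"

definition simple_graph :: "'a ugraph \<Rightarrow> bool" where
  "simple_graph G \<longleftrightarrow>
     (\<forall>e\<in>edges G. \<exists>u v. e = {u, v} \<and> u \<noteq> v \<and> u \<in> verts G \<and> v \<in> verts G)"

definition walk :: "'a ugraph \<Rightarrow> 'a \<Rightarrow> 'a list \<Rightarrow> 'a \<Rightarrow> bool" where
  "walk G u xs v \<longleftrightarrow>
     xs \<noteq> [] \<and> hd xs = u \<and> last xs = v \<and> set xs \<subseteq> verts G \<and>
     (\<forall>i. Suc i < length xs \<longrightarrow> {xs ! i, xs ! Suc i} \<in> edges G)"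

text \<open>Walks are lists of vertices, so the number of edges is one less than the length of the
  list. The infimum over the empty set is \<open>\<infinity>\<close>, so vertices in different components
  are at infinite distance.\<close>

definition gdist :: "'a ugraph \<Rightarrow> 'a \<Rightarrow> 'a \<Rightarrow> enat" where
  "gdist G u v = (INF xs \<in> {xs. walk G u xs v}. enat (length xs - 1))"

text \<open>The inequalities are between extended reals: for \<open>c \<ge> 1\<close> they force \<open>\<phi>\<close> to map two
  vertices to the same component exactly when they lie in the same component.\<close>

definition quasi_isometry :: "real \<Rightarrow> 'a ugraph \<Rightarrow> 'b ugraph \<Rightarrow> ('a \<Rightarrow> 'b) \<Rightarrow> bool" where
  "quasi_isometry c G H \<phi> \<longleftrightarrow>
     \<phi> ` verts G \<subseteq> verts H \<and>
     (\<forall>u\<in>verts G. \<forall>v\<in>verts G. u \<noteq> v \<longrightarrow>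
        ereal_of_enat (gdist G u v)
          \<le> ereal c * ereal_of_enat (gdist H (\<phi> u) (\<phi> v)) + ereal c \<and>
        ereal_of_enat (gdist H (\<phi> u) (\<phi> v))
          \<le> ereal c * ereal_of_enat (gdist G u v) + ereal c) \<and>
     (\<forall>h\<in>verts H. \<exists>v\<in>verts G. ereal_of_enat (gdist H h (\<phi> v)) \<le> ereal c)"

definition quasi_isometric :: "real \<Rightarrow> 'a ugraph \<Rightarrow> 'b ugraph \<Rightarrow> bool" where
  "quasi_isometric c G H \<longleftrightarrow> (\<exists>\<phi>. quasi_isometry c G H \<phi>)"

text \<open>The list gives the bags in the order of the nodes of the (finite) indexing path; the last
  condition says that the bags containing a given vertex are consecutive.\<close>

definition path_decomposition :: "'a ugraph \<Rightarrow> 'a set list \<Rightarrow> bool" where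
  "path_decomposition G Bs \<longleftrightarrow>
     Bs \<noteq> [] \<and> \<Union>(set Bs) = verts G \<and>
     (\<forall>e\<in>edges G. \<exists>B\<in>set Bs. e \<subseteq> B) \<and>
     (\<forall>i j l. i \<le> j \<and> j \<le> l \<and> l < length Bs \<longrightarrow> Bs ! i \<inter> Bs ! l \<subseteq> Bs ! j)"

text \<open>Subtraction on \<^typ>\<open>enat\<close> is truncated, so if all bags are empty the width is \<open>0\<close> and
  not \<open>-1\<close>; this concerns only the graph without vertices.\<close>

definition width :: "'a set list \<Rightarrow> enat" where
  "width Bs = (SUP B \<in> set Bs. if finite B then enat (card B) else \<infinity>) - 1"

definition pathwidth :: "'a ugraph \<Rightarrow> enat" where
  "pathwidth G = (INF Bs \<in> {Bs. path_decomposition G Bs}. width Bs)"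

definition quotient_graph :: "'a ugraph \<Rightarrow> 'a set set \<Rightarrow> 'a set ugraph" where
  "quotient_graph G \<P> =
     \<lparr>verts = \<P>,
      edges = {{P, Q} | P Q. P \<in> \<P> \<and> Q \<in> \<P> \<and> P \<noteq> Q \<and>
                 (\<exists>u\<in>P. \<exists>v\<in>Q. {u, v} \<in> edges G)}\<rparr>"

definition weak_diameter :: "'a ugraph \<Rightarrow> 'a set \<Rightarrow> enat" where
  "weak_diameter G S = (SUP u\<in>S. SUP v\<in>S. gdist G u v)"

lemma simple_graph_quotient_graph: "simple_graph (quotient_graph G \<P>)"
  by (auto simp: simple_graph_def quotient_graph_def)

lemma width_le_iff: "width Bs \<le> enat k \<longleftrightarrow> (\<forall>B\<in>set Bs. finite B \<and> card B \<le> k + 1)"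
proof -
  have minus_le: "a - 1 \<le> enat k \<longleftrightarrow> a \<le> enat (k + 1)" for a :: enat
    by (cases a) (auto simp: one_enat_def)
  show ?thesis
    unfolding width_def minus_le SUP_le_iff by auto
qed

lemma pathwidth_le_iff:
  "pathwidth G \<le> enat k \<longleftrightarrow>
     (\<exists>Bs. path_decomposition G Bs \<and> (\<forall>B\<in>set Bs. finite B \<and> card B \<le> k + 1))"
proof
  assume le: "pathwidth G \<le> enat k"
  let ?W = "width ` {Bs. path_decomposition G Bs}"
  have "?W \<noteq> {}"
  proof
    assume "?W = {}"
    then have "pathwidth G = \<infinity>"
      unfolding pathwidth_def by (simp only: Inf_empty top_enat_def)
    with le show False by simp
  qed
  then have "Inf ?W \<in> ?W"
    by (metis Inf_enat_def LeastI_ex ex_in_conv)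
  then show "\<exists>Bs. path_decomposition G Bs \<and> (\<forall>B\<in>set Bs. finite B \<and> card B \<le> k + 1)"
    using le unfolding pathwidth_def by (auto simp: width_le_iff)
next
  assume "\<exists>Bs. path_decomposition G Bs \<and> (\<forall>B\<in>set Bs. finite B \<and> card B \<le> k + 1)"
  then obtain Bs where "path_decomposition G Bs" "width Bs \<le> enat k"
    by (auto simp: width_le_iff)
  then show "pathwidth G \<le> enat k"
    unfolding pathwidth_def by (blast intro: INF_lower2)
qed

end

theory Submission
  imports Defs
begin

text \<open>Two adjacent vertices of \<open>G\<close> are mapped to vertices of \<open>H\<close> at distance at most \<open>r = \<lfloor>2c\<rfloor>\<close>, so it
  suffices to partition \<open>H\<close> into parts of weak diameter at most \<open>2 (k + 1) r\<close> such that the quotient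
  of the \<open>r\<close>-th power of \<open>H\<close> has pathwidth at most \<open>k\<close>. To this end we adapt the buffered cop
  decomposition of Chang, Conroy, Tan and Zheng. Sweep the bags from left to right. Each vertex that
  is still free when it is met starts a new connected cell. As soon as a cell \<open>X\<close> has left the
  current bag, every free vertex that can be reached from \<open>X\<close> by a path of length at most
  \<open>\<gamma> = 2 \<lceil>r / 2\<rceil>\<close> avoiding the cells older than \<open>X\<close> joins the last cell on such a path, which is
  younger than \<open>X\<close>. A cell thus grows only on behalf of the at most \<open>k\<close> older cells that met the
  bag in which it started, by at most \<open>\<gamma> - 1\<close> each time, and any two cells joined by a path of length
  at most \<open>\<gamma>\<close> on which one of them is the oldest cell share a bag. Being disjoint and
  connected, the cells inherit the path decomposition of \<open>H\<close>.\<close>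

section \<open>Paths as powers of a relation\<close>

lemma sym_relpow:
  assumes "sym R" "(x, y) \<in> R ^^ n"
  shows "(y, x) \<in> R ^^ n"
  using assms(2)
proof (induction n arbitrary: y)
  case (Suc n)
  then obtain z where "(x, z) \<in> R ^^ n" "(z, y) \<in> R" by auto
  with Suc.IH assms(1) show ?case
    by (meson relpow_Suc_I2 symD)
qed auto

lemma relpow_mono:
  fixes R S :: "('a \<times> 'a) set"
  assumes "R \<subseteq> S" "(x, y) \<in> R ^^ l"
  shows "(x, y) \<in> S ^^ l"
  using assms(2)
proof (induction l arbitrary: y)
  case (Suc l)
  then obtain w where "(x, w) \<in> R ^^ l" "(w, y) \<in> R" by auto
  with Suc.IH assms(1) show ?case by auto
qed simp

section \<open>Connected sets in a path decomposition, with edges as a symmetric relation\<close>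

locale bag_sequence =
  fixes V :: "'b set" and E :: "('b \<times> 'b) set" and B :: "nat \<Rightarrow> 'b set" and n k \<gamma> :: nat
  assumes E_sym: "sym E"
    and E_V: "E \<subseteq> V \<times> V"
    and bags_V: "(\<Union>i<n. B i) = V"
    and bags_E: "(u, v) \<in> E \<Longrightarrow> \<exists>i<n. u \<in> B i \<and> v \<in> B i"
    and bags_convex: "\<lbrakk>a \<le> b; b \<le> c; c < n; v \<in> B a; v \<in> B c\<rbrakk> \<Longrightarrow> v \<in> B b"
    and bags_finite: "i < n \<Longrightarrow> finite (B i)"
    and bags_card: "i < n \<Longrightarrow> card (B i) \<le> k + 1"
    and \<gamma>_pos: "0 < \<gamma>"
begin

text \<open>If \<open>X\<close> missed bag \<open>b\<close>, a walk inside \<open>X\<close> could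
  never leave the bags before \<open>b\<close>: the bag shared by the ends of its next edge also
  lies before \<open>b\<close>, as otherwise convexity would put a vertex of \<open>X\<close> into
  bag \<open>b\<close>.\<close>

lemma connected_left:
  assumes "(u, v) \<in> (Restr E X)\<^sup>*" "u \<in> X" "u \<in> B a" "a \<le> b" "v \<in> B c" "b \<le> c" "c < n"
  shows "X \<inter> B b \<noteq> {}"
proof
  assume empty: "X \<inter> B b = {}"
  have "v \<in> X \<and> (\<exists>a<b. v \<in> B a)"
    using assms(1)
  proof (induction rule: rtrancl_induct)
    case base
    then show ?case using assms(2-4) empty by (cases "a = b") (auto simp: le_less)
  next
    case (step v w)
    obtain a where v: "v \<in> X" "a < b" "v \<in> B a" using step.IH by auto
    have "(v, w) \<in> E" using step.hyps by simp
    then obtain i where i: "i < n" "v \<in> B i" "w \<in> B i" using bags_E by auto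
    have "i < b"
    proof (rule ccontr)
      assume "\<not> i < b"
      then have "v \<in> B b" using bags_convex[of a b i v] v i by simp
      then show False using v empty by auto
    qed
    then show ?case using step.hyps i by auto
  qed
  then obtain a where "v \<in> X" "a < b" "v \<in> B a" by auto
  then show False using bags_convex[of a b c v] assms(5-7) empty by auto
qed

lemma connected_convex:
  assumes "\<And>v. v \<in> X \<Longrightarrow> (x, v) \<in> (Restr E X)\<^sup>*" "u \<in> X" "u \<in> B a" "v \<in> X" "v \<in> B c"
    and "a \<le> b" "b \<le> c" "c < n"
  shows "X \<inter> B b \<noteq> {}"
proof (rule connected_left)
  have "sym (Restr E X)" using E_sym by (auto simp: sym_def)
  then have "sym ((Restr E X)\<^sup>*)" by (rule sym_rtrancl)
  then show "(u, v) \<in> (Restr E X)\<^sup>*"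
    using assms(1)[of u] assms(1)[of v] assms by (meson rtrancl_trans symD)
qed (use assms in auto)

text \<open>In a map \<open>f\<close> into \<^typ>\<open>enat\<close>, the value \<open>\<infinity>\<close> marks the vertices that do not belong to a cell
  yet; the finite values are the ages of the cells, \<open>0\<close> being the oldest.\<close>

definition cell :: "('b \<Rightarrow> enat) \<Rightarrow> nat \<Rightarrow> 'b set" where
  "cell f i = {v \<in> V. f v = enat i}"

text \<open>Free vertices have value \<open>\<infinity>\<close>, so paths in
  \<open>upward f j\<close> may use them; only cells older than \<open>j\<close> are avoided.
  Accordingly \<open>reach f j m\<close> is the ball of radius \<open>m\<close> around cell
  \<open>j\<close> in what remains after deleting the older cells.\<close>

definition upward :: "('b \<Rightarrow> enat) \<Rightarrow> nat \<Rightarrow> ('b \<times> 'b) set" where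
  "upward f j = {(x, y) \<in> E. enat j \<le> f x \<and> enat j \<le> f y}"

definition reach :: "('b \<Rightarrow> enat) \<Rightarrow> nat \<Rightarrow> nat \<Rightarrow> 'b set" where
  "reach f j m = {v. \<exists>u\<in>cell f j. \<exists>l\<le>m. (u, v) \<in> upward f j ^^ l}"

text \<open>The state when the bags before \<open>t\<close> have been processed: \<open>N\<close> cells exist, cell \<open>i\<close> was created
  at the vertex \<open>z i\<close> of bag \<open>\<sigma> i\<close> and has radius at most \<open>R i\<close>, and \<open>D\<close> consists of the dead
  cells, which do not meet the bags from \<open>t\<close> on and whose buffer of width \<open>\<gamma>\<close> has been filled.\<close>

definition state ::
  "nat \<Rightarrow> ('b \<Rightarrow> enat) \<Rightarrow> nat \<Rightarrow> (nat \<Rightarrow> nat) \<Rightarrow> (nat \<Rightarrow> 'b) \<Rightarrow> nat set \<Rightarrow> (nat \<Rightarrow> nat) \<Rightarrow> bool"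
where
  "state t f N \<sigma> z D R \<longleftrightarrow>
     (\<forall>v\<in>V. f v = \<infinity> \<or> (\<exists>i<N. f v = enat i)) \<and>
     (\<forall>s<t. \<forall>v\<in>B s. f v \<noteq> \<infinity>) \<and>
     (\<forall>i<N. \<sigma> i \<le> t \<and> \<sigma> i < n \<and> z i \<in> B (\<sigma> i) \<and> z i \<in> cell f i) \<and>
     (\<forall>i<N. \<forall>v\<in>cell f i. (z i, v) \<in> (Restr E (cell f i))\<^sup>*) \<and>
     (\<forall>i<N. \<forall>v\<in>cell f i. \<exists>l\<le>R i. (z i, v) \<in> E ^^ l) \<and>
     (\<forall>j\<in>D. j < N \<and> (\<forall>s. t \<le> s \<and> s < n \<longrightarrow> cell f j \<inter> B s = {})) \<and>
     (\<forall>j\<in>D. \<forall>v\<in>reach f j \<gamma>. f v \<noteq> \<infinity>) \<and>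
     (\<forall>i<N. \<forall>j<i. cell f j \<inter> B (\<sigma> i) = {} \<longrightarrow> j \<in> D \<and> reach f j \<gamma> \<inter> cell f i = {})"

section \<open>Invariants of the sweep and their stability under growth\<close>

lemma stateD:
  assumes "state t f N \<sigma> z D R"
  shows "v \<in> V \<Longrightarrow> f v = \<infinity> \<or> (\<exists>i<N. f v = enat i)"
    and "s < t \<Longrightarrow> v \<in> B s \<Longrightarrow> f v \<noteq> \<infinity>"
    and "i < N \<Longrightarrow> \<sigma> i \<le> t" "i < N \<Longrightarrow> \<sigma> i < n" "i < N \<Longrightarrow> z i \<in> B (\<sigma> i)" "i < N \<Longrightarrow> z i \<in> cell f i"
    and "i < N \<Longrightarrow> v \<in> cell f i \<Longrightarrow> (z i, v) \<in> (Restr E (cell f i))\<^sup>*"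
    and "i < N \<Longrightarrow> v \<in> cell f i \<Longrightarrow> \<exists>l\<le>R i. (z i, v) \<in> E ^^ l"
    and "j \<in> D \<Longrightarrow> j < N"
    and "j \<in> D \<Longrightarrow> t \<le> s \<Longrightarrow> s < n \<Longrightarrow> cell f j \<inter> B s = {}"
    and "j \<in> D \<Longrightarrow> v \<in> reach f j \<gamma> \<Longrightarrow> f v \<noteq> \<infinity>"
    and "i < N \<Longrightarrow> j < i \<Longrightarrow> cell f j \<inter> B (\<sigma> i) = {} \<Longrightarrow> j \<in> D"
    and "i < N \<Longrightarrow> j < i \<Longrightarrow> cell f j \<inter> B (\<sigma> i) = {} \<Longrightarrow> reach f j \<gamma> \<inter> cell f i = {}"
proof -
  note c1 = assms[unfolded state_def]
  note c2 = c1[THEN conjunct2] note c3 = c2[THEN conjunct2] note c4 = c3[THEN conjunct2]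
  note c5 = c4[THEN conjunct2] note c6 = c5[THEN conjunct2] note c7 = c6[THEN conjunct2]
  show "v \<in> V \<Longrightarrow> f v = \<infinity> \<or> (\<exists>i<N. f v = enat i)"
    by (rule c1[THEN conjunct1, rule_format])
  show "s < t \<Longrightarrow> v \<in> B s \<Longrightarrow> f v \<noteq> \<infinity>"
    by (rule c2[THEN conjunct1, rule_format])
  show "i < N \<Longrightarrow> \<sigma> i \<le> t" "i < N \<Longrightarrow> \<sigma> i < n" "i < N \<Longrightarrow> z i \<in> B (\<sigma> i)" "i < N \<Longrightarrow> z i \<in> cell f i"
    using c3[THEN conjunct1] by blast+
  show "i < N \<Longrightarrow> v \<in> cell f i \<Longrightarrow> (z i, v) \<in> (Restr E (cell f i))\<^sup>*"
    by (rule c4[THEN conjunct1, rule_format])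
  show "i < N \<Longrightarrow> v \<in> cell f i \<Longrightarrow> \<exists>l\<le>R i. (z i, v) \<in> E ^^ l"
    by (rule c5[THEN conjunct1, rule_format])
  show "j \<in> D \<Longrightarrow> j < N" "j \<in> D \<Longrightarrow> t \<le> s \<Longrightarrow> s < n \<Longrightarrow> cell f j \<inter> B s = {}"
    using c6[THEN conjunct1] by blast+
  show "j \<in> D \<Longrightarrow> v \<in> reach f j \<gamma> \<Longrightarrow> f v \<noteq> \<infinity>"
    by (rule c7[THEN conjunct1, rule_format])
  show "i < N \<Longrightarrow> j < i \<Longrightarrow> cell f j \<inter> B (\<sigma> i) = {} \<Longrightarrow> j \<in> D"
    and "i < N \<Longrightarrow> j < i \<Longrightarrow> cell f j \<inter> B (\<sigma> i) = {} \<Longrightarrow> reach f j \<gamma> \<inter> cell f i = {}"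
    using c7[THEN conjunct2, rule_format, of i j] by auto
qed

lemma stateI:
  assumes "\<And>v. v \<in> V \<Longrightarrow> f v = \<infinity> \<or> (\<exists>i<N. f v = enat i)"
    and "\<And>s v. s < t \<Longrightarrow> v \<in> B s \<Longrightarrow> f v \<noteq> \<infinity>"
    and "\<And>i. i < N \<Longrightarrow> \<sigma> i \<le> t \<and> \<sigma> i < n \<and> z i \<in> B (\<sigma> i) \<and> z i \<in> cell f i"
    and "\<And>i v. i < N \<Longrightarrow> v \<in> cell f i \<Longrightarrow> (z i, v) \<in> (Restr E (cell f i))\<^sup>*"
    and "\<And>i v. i < N \<Longrightarrow> v \<in> cell f i \<Longrightarrow> \<exists>l\<le>R i. (z i, v) \<in> E ^^ l"
    and "\<And>j. j \<in> D \<Longrightarrow> j < N"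
    and "\<And>j s. j \<in> D \<Longrightarrow> t \<le> s \<Longrightarrow> s < n \<Longrightarrow> cell f j \<inter> B s = {}"
    and "\<And>j v. j \<in> D \<Longrightarrow> v \<in> reach f j \<gamma> \<Longrightarrow> f v \<noteq> \<infinity>"
    and "\<And>i j. i < N \<Longrightarrow> j < i \<Longrightarrow> cell f j \<inter> B (\<sigma> i) = {} \<Longrightarrow>
           j \<in> D \<and> reach f j \<gamma> \<inter> cell f i = {}"
  shows "state t f N \<sigma> z D R"
  unfolding state_def
proof (intro conjI)
  show "\<forall>j\<in>D. j < N \<and> (\<forall>s. t \<le> s \<and> s < n \<longrightarrow> cell f j \<inter> B s = {})"
    using assms(6,7) by blast
qed (intro allI ballI impI, rule assms; assumption)+

text \<open>The bag shared by \<open>x\<close> and \<open>y\<close> lies before \<open>t\<close>,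
  because cell \<open>j\<close> misses all later ones, and the bags before \<open>t\<close> contain
  no free vertex.\<close>

lemma neighbours_assigned:
  assumes "state t f N \<sigma> z D R" "\<And>s. t \<le> s \<Longrightarrow> s < n \<Longrightarrow> cell f j \<inter> B s = {}"
    and "x \<in> cell f j" "(x, y) \<in> E"
  shows "f y \<noteq> \<infinity>"
proof -
  obtain s where "s < n" "x \<in> B s" "y \<in> B s" using bags_E assms(4) by blast
  then show ?thesis using assms stateD(2)[OF assms(1)] by (metis IntI emptyE not_less)
qed

text \<open>Assigning a free vertex lowers its value from \<open>\<infinity>\<close>, so
  \<open>upward\<close> can lose edges but never gains any.\<close>

lemma grow_reach:
  assumes "\<And>v. f v \<noteq> \<infinity> \<Longrightarrow> f' v = f v" "cell f' j = cell f j"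
  shows "reach f' j m \<subseteq> reach f j m"
proof -
  have "enat j \<le> f' x \<Longrightarrow> enat j \<le> f x" for x using assms(1)[of x] by (cases "f x") auto
  then have "upward f' j \<subseteq> upward f j" unfolding upward_def by auto
  then show ?thesis using assms(2) relpow_mono[of "upward f' j" "upward f j"] unfolding reach_def by blast
qed

text \<open>All vertices of \<open>Z\<close> join the cells of their neighbours at once, which costs
  one unit of radius. Dead cells gain nothing, having no free neighbours, and their filled buffers
  contain no free vertex. Hence no vertex of \<open>Z\<close> can violate the buffer
  invariant.\<close>

lemma grow:
  assumes st: "state t f N \<sigma> z D R"
    and Z: "\<And>v. v \<in> Z \<Longrightarrow> v \<in> V \<and> f v = \<infinity> \<and> (y v, v) \<in> E \<and> f (y v) \<noteq> \<infinity>"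
    and R': "\<And>i. R i \<le> R' i" "\<And>v i. v \<in> Z \<Longrightarrow> f (y v) = enat i \<Longrightarrow> R i < R' i"
    and f': "f' = (\<lambda>v. if v \<in> Z then f (y v) else f v)"
  shows "state t f' N \<sigma> z D R'"
proof -
  note D = stateD[OF st]
  have keep: "f' v = f v" if "f v \<noteq> \<infinity>" for v using that Z f' by auto
  have yV: "y v \<in> V" if "v \<in> Z" for v using Z that E_V by blast
  have mono: "cell f i \<subseteq> cell f' i" for i unfolding cell_def using keep by auto
  have new: "v \<in> cell f i \<or> v \<in> Z \<and> y v \<in> cell f i" if "v \<in> cell f' i" for v i
    using that yV unfolding cell_def f' by (auto split: if_splits)
  have dead: "cell f' j = cell f j" if "j \<in> D" for j
  proof
    show "cell f' j \<subseteq> cell f j"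
      using new neighbours_assigned[OF st D(10)[OF that]] Z by blast
  qed (rule mono)
  show ?thesis
  proof (rule stateI)
    show "f' v = \<infinity> \<or> (\<exists>i<N. f' v = enat i)" if "v \<in> V" for v
      using D(1) that yV unfolding f' by auto
    show "f' v \<noteq> \<infinity>" if "s < t" "v \<in> B s" for s v using D(2) keep that by metis
    show "\<sigma> i \<le> t \<and> \<sigma> i < n \<and> z i \<in> B (\<sigma> i) \<and> z i \<in> cell f' i" if "i < N" for i
      using D(3,4,5,6) that mono by blast
    show "(z i, v) \<in> (Restr E (cell f' i))\<^sup>*" if i: "i < N" "v \<in> cell f' i" for i v
    proof -
      have sub: "(Restr E (cell f i))\<^sup>* \<subseteq> (Restr E (cell f' i))\<^sup>*"
        by (rule rtrancl_mono) (use mono in blast)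
      from new[OF i(2)] show ?thesis
      proof
        assume "v \<in> cell f i"
        then show ?thesis using D(7) i sub by blast
      next
        assume v: "v \<in> Z \<and> y v \<in> cell f i"
        then have "(z i, y v) \<in> (Restr E (cell f' i))\<^sup>*" using D(7) i sub by blast
        moreover have "(y v, v) \<in> Restr E (cell f' i)" using v i mono Z by blast
        ultimately show ?thesis by (rule rtrancl_into_rtrancl)
      qed
    qed
    show "\<exists>l\<le>R' i. (z i, v) \<in> E ^^ l" if i: "i < N" "v \<in> cell f' i" for i v
      using new[OF i(2)]
    proof
      assume "v \<in> cell f i"
      then show ?thesis using D(8) i R'(1) by (meson le_trans)
    next
      assume v: "v \<in> Z \<and> y v \<in> cell f i"
      then obtain l where l: "l \<le> R i" "(z i, y v) \<in> E ^^ l" using D(8) i by blast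
      have "(z i, v) \<in> E ^^ Suc l" using l(2) v Z by auto
      moreover have "Suc l \<le> R' i" using l(1) R'(2)[of v i] v unfolding cell_def by simp
      ultimately show ?thesis by blast
    qed
    show "j < N" if "j \<in> D" for j using D(9) that .
    show "cell f' j \<inter> B s = {}" if "j \<in> D" "t \<le> s" "s < n" for j s
      using D(10) dead that by simp
    show "f' v \<noteq> \<infinity>" if "j \<in> D" "v \<in> reach f' j \<gamma>" for j v
      using D(11) dead grow_reach[of f f' j] keep that by (metis subsetD)
    show "j \<in> D \<and> reach f' j \<gamma> \<inter> cell f' i = {}"
      if ij: "i < N" "j < i" "cell f' j \<inter> B (\<sigma> i) = {}" for i j
    proof -
      have e: "cell f j \<inter> B (\<sigma> i) = {}" using ij mono by blast
      have j: "j \<in> D" using D(12) ij e by blast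
      have "reach f' j \<gamma> \<subseteq> reach f j \<gamma>" using grow_reach[of f f'] keep dead[OF j] by blast
      then show ?thesis using D(13)[OF ij(1,2) e] D(11)[OF j] j new Z by blast
    qed
  qed
qed

section \<open>The steps of the sweep: filling buffers and creating cells\<close>

text \<open>These are the cells on whose behalf cell \<open>i\<close> may have grown; their number
  times \<open>\<gamma> - 1\<close> bounds its radius.\<close>

definition elders :: "('b \<Rightarrow> enat) \<Rightarrow> (nat \<Rightarrow> nat) \<Rightarrow> nat set \<Rightarrow> nat \<Rightarrow> nat set" where
  "elders f \<sigma> D i = {j \<in> D. j < i \<and> cell f j \<inter> B (\<sigma> i) \<noteq> {}}"

text \<open>Declares cell \<open>j\<close> dead after filling its buffer layer by layer, by
  induction on the distance from the cell.\<close>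

lemma cut:
  assumes st: "state t f N \<sigma> z D (\<lambda>i. card (elders f \<sigma> D i) * (\<gamma> - 1))"
    and j: "j < N" "j \<notin> D" "cell f j \<inter> B t = {}" and t: "t < n"
  shows "\<exists>f'. state t f' N \<sigma> z (insert j D) (\<lambda>i. card (elders f' \<sigma> (insert j D) i) * (\<gamma> - 1))"
proof -
  note D = stateD[OF st]
  \<comment> \<open>Cell \<open>j\<close> is connected and meets bag \<open>\<sigma> j\<close> with
    \<open>\<sigma> j \<le> t\<close>, so missing bag \<open>t\<close> means missing every later
    bag.\<close>
  have past: "cell f j \<inter> B s = {}" if "t \<le> s" "s < n" for s
  proof (rule ccontr)
    assume "cell f j \<inter> B s \<noteq> {}"
    then obtain v where v: "v \<in> cell f j" "v \<in> B s" by blast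
    have "cell f j \<inter> B t \<noteq> {}"
      using connected_convex[of "cell f j" "z j" "z j" "\<sigma> j" v s t] D(3-7) j v that by blast
    then show False using j by simp
  qed
  \<comment> \<open>The radius bound once distances up to \<open>m + 1\<close> are filled: only
    younger cells whose starting bag meets cell \<open>j\<close> pay, one unit per further
    layer.\<close>
  define R where "R m i = card (elders f \<sigma> D i) * (\<gamma> - 1) +
    (if j < i \<and> cell f j \<inter> B (\<sigma> i) \<noteq> {} then m else 0)" for m i
  have "\<exists>f'. state t f' N \<sigma> z D (R m) \<and> (\<forall>v. f v \<noteq> \<infinity> \<longrightarrow> f' v = f v) \<and> cell f' j = cell f j \<and>
      (\<forall>v\<in>reach f' j (Suc m). f' v \<noteq> \<infinity>)" if "Suc m \<le> \<gamma>" for m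
    using that
  proof (induction m)
    \<comment> \<open>Distance one needs no growth, since all neighbours of cell \<open>j\<close>
      are already assigned. Hence a cut costs \<open>\<gamma> - 1\<close> and not
      \<open>\<gamma>\<close>.\<close>
    case 0
    have "state t f N \<sigma> z D (R 0)" using st unfolding R_def by (simp cong: if_cong)
    moreover have "f v \<noteq> \<infinity>" if v: "v \<in> reach f j (Suc 0)" for v
    proof -
      obtain u l where u: "u \<in> cell f j" "l \<le> Suc 0" "(u, v) \<in> upward f j ^^ l"
        using v unfolding reach_def by blast
      then consider "u = v" | "(u, v) \<in> E" by (cases l) (auto simp: upward_def)
      then show ?thesis
        using u(1) neighbours_assigned[OF st past] by cases (auto simp: cell_def)
    qed
    ultimately show ?case by blast
  next
    case (Suc m)
    then obtain g where g: "state t g N \<sigma> z D (R m)" "\<And>v. f v \<noteq> \<infinity> \<Longrightarrow> g v = f v"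
      "cell g j = cell f j" "\<And>v. v \<in> reach g j (Suc m) \<Longrightarrow> g v \<noteq> \<infinity>" by auto
    note G = stateD[OF g(1)]
    define Z where "Z = {v \<in> V. g v = \<infinity> \<and> v \<in> reach g j (Suc (Suc m))}"
    \<comment> \<open>The vertex before \<open>v\<close> on its path is one step closer to cell
      \<open>j\<close>, so it is already assigned, and \<open>v\<close> can join its cell.\<close>
    have pred: "\<exists>y. (y, v) \<in> E \<and> y \<in> reach g j (Suc m) \<and> enat j \<le> g y" if v: "v \<in> Z" for v
    proof -
      obtain u l where u: "u \<in> cell g j" "l \<le> Suc (Suc m)" "(u, v) \<in> upward g j ^^ l"
        using v unfolding Z_def reach_def by blast
      have "l \<noteq> 0"
        using u v unfolding Z_def cell_def by (intro notI) auto
      then obtain l' where l': "l = Suc l'" by (cases l) auto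
      with u obtain y where "(u, y) \<in> upward g j ^^ l'" "(y, v) \<in> upward g j" by auto
      then show ?thesis using u l' unfolding reach_def upward_def by auto
    qed
    then obtain y where y: "\<And>v. v \<in> Z \<Longrightarrow> (y v, v) \<in> E"
        "\<And>v. v \<in> Z \<Longrightarrow> y v \<in> reach g j (Suc m)" "\<And>v. v \<in> Z \<Longrightarrow> enat j \<le> g (y v)"
      by metis
    define g' where "g' = (\<lambda>v. if v \<in> Z then g (y v) else g v)"
    \<comment> \<open>A free vertex has no neighbour in cell \<open>j\<close>, so the cell that
      grows is strictly younger than \<open>j\<close>.\<close>
    have not_j: "g (y v) \<noteq> enat j" if v: "v \<in> Z" for v
    proof
      assume "g (y v) = enat j"
      then have "y v \<in> cell g j" using y(1)[OF v] E_V unfolding cell_def by auto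
      then have "g v \<noteq> \<infinity>"
        using neighbours_assigned[OF g(1), of j] past g(3) y(1)[OF v] by simp
      then show False using v unfolding Z_def by simp
    qed
    have st': "state t g' N \<sigma> z D (R (Suc m))"
    proof (rule grow[OF g(1) _ _ _ g'_def])
      show "v \<in> V \<and> g v = \<infinity> \<and> (y v, v) \<in> E \<and> g (y v) \<noteq> \<infinity>" if "v \<in> Z" for v
        using that y g(4) unfolding Z_def by blast
      show "R m i \<le> R (Suc m) i" for i unfolding R_def by simp
      show "R m i < R (Suc m) i" if v: "v \<in> Z" and i: "g (y v) = enat i" for v i
      proof -
        have yv: "y v \<in> cell g i" using y(1)[OF v] E_V i unfolding cell_def by auto
        have ji: "j < i" using y(3)[OF v] not_j[OF v] i by (metis enat_ord_simps(1) le_neq_implies_less)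
        have "y v \<in> V" using yv unfolding cell_def by simp
        then have iN: "i < N" using G(1)[of "y v"] i by auto
        \<comment> \<open>Contrapositive of the buffer invariant: cell \<open>i\<close> meets the
          reach of \<open>j\<close>, so cell \<open>j\<close> meets the starting bag of
          \<open>i\<close>, and \<open>i\<close> is among the cells that \<open>R\<close>
          charges.\<close>
        have "y v \<in> reach g j \<gamma>"
          using y(2)[OF v] Suc.prems unfolding reach_def by (blast intro: le_trans Suc_leD)
        then have "cell g j \<inter> B (\<sigma> i) \<noteq> {}" using G(13)[OF iN ji] yv by blast
        then show ?thesis using ji g(3) unfolding R_def by simp
      qed
    qed
    have keep: "g' v = g v" if "g v \<noteq> \<infinity>" for v
    proof -
      have "v \<notin> Z" using that unfolding Z_def by blast
      then show ?thesis unfolding g'_def by simp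
    qed
    have cells: "cell g' j = cell g j"
      using keep not_j unfolding cell_def g'_def Z_def by auto
    have "g' v \<noteq> \<infinity>" if v: "v \<in> reach g' j (Suc (Suc m))" for v
    proof -
      have r: "v \<in> reach g j (Suc (Suc m))" using v grow_reach[of g g'] keep cells by blast
      then obtain u l where u: "u \<in> cell g j" "(u, v) \<in> upward g j ^^ l"
        unfolding reach_def by blast
      have "v \<in> V" using u E_V by (cases l) (auto simp: upward_def cell_def)
      then show ?thesis using r y(2) g(4) unfolding g'_def Z_def by auto
    qed
    then show ?case using st' keep cells g(2,3) by (metis (no_types, lifting))
  qed
  from this[of "\<gamma> - 1"] \<gamma>_pos obtain g where g: "state t g N \<sigma> z D (R (\<gamma> - 1))"
    "\<And>v. f v \<noteq> \<infinity> \<Longrightarrow> g v = f v" "cell g j = cell f j" "\<And>v. v \<in> reach g j \<gamma> \<Longrightarrow> g v \<noteq> \<infinity>" by auto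
  note G = stateD[OF g(1)]
  \<comment> \<open>Dead cells lie entirely in bags before \<open>t\<close>, whose vertices already
    had their final ages in \<open>f\<close>.\<close>
  have dead: "cell g i = cell f i" if "i \<in> D" for i
  proof
    show "cell f i \<subseteq> cell g i" using g(2) unfolding cell_def by auto
    show "cell g i \<subseteq> cell f i"
    proof
      fix v assume v: "v \<in> cell g i"
      obtain s where s: "s < n" "v \<in> B s" using v bags_V unfolding cell_def by blast
      have "s < t" using G(10)[OF that] v s by (metis IntI emptyE not_less)
      then show "v \<in> cell f i" using D(2) s g(2) v unfolding cell_def by auto
    qed
  qed
  have fin: "finite D" using D(9) by (meson finite_nat_iff_bounded lessThan_iff subsetI)
  \<comment> \<open>As \<open>elders\<close> counts dead cells only, and these did not change, the
    count differs only by the insertion of \<open>j\<close>.\<close>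
  have R_eq: "R (\<gamma> - 1) i = card (elders g \<sigma> (insert j D) i) * (\<gamma> - 1)" for i
  proof (cases "j < i \<and> cell f j \<inter> B (\<sigma> i) \<noteq> {}")
    case True
    then have "elders g \<sigma> (insert j D) i = insert j (elders f \<sigma> D i)"
      unfolding elders_def using g(3) dead by auto
    moreover have "j \<notin> elders f \<sigma> D i" "finite (elders f \<sigma> D i)"
      using j fin unfolding elders_def by auto
    ultimately show ?thesis using True unfolding R_def by simp
  next
    case False
    then have "elders g \<sigma> (insert j D) i = elders f \<sigma> D i"
      unfolding elders_def using g(3) dead by auto
    then show ?thesis using False unfolding R_def by auto
  qed
  then have "R (\<gamma> - 1) = (\<lambda>i. card (elders g \<sigma> (insert j D) i) * (\<gamma> - 1))" by blast
  moreover have "state t g N \<sigma> z (insert j D) (R (\<gamma> - 1))"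
  proof (rule stateI)
    show "i < N" if "i \<in> insert j D" for i using that j G(9) by blast
    show "cell g i \<inter> B s = {}" if "i \<in> insert j D" "t \<le> s" "s < n" for i s
      by (cases "i = j") (use that past g(3) G(10)[of i s] in auto)
    show "g v \<noteq> \<infinity>" if "i \<in> insert j D" "v \<in> reach g i \<gamma>" for i v
      using that g(4) G(11) by blast
    show "i' \<in> insert j D \<and> reach g i' \<gamma> \<inter> cell g i = {}"
      if "i < N" "i' < i" "cell g i' \<inter> B (\<sigma> i) = {}" for i i'
      using G(12,13)[OF that] by blast
    show "\<sigma> i \<le> t \<and> \<sigma> i < n \<and> z i \<in> B (\<sigma> i) \<and> z i \<in> cell g i" if "i < N" for i
      using G(3-6)[OF that] by simp
  qed (rule G(1) G(2) G(7) G(8); assumption)+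
  ultimately have "state t g N \<sigma> z (insert j D) (\<lambda>i. card (elders g \<sigma> (insert j D) i) * (\<gamma> - 1))"
    by (rule subst[where P = "state t g N \<sigma> z (insert j D)"])
  then show ?thesis
    by (rule exI[where P = "\<lambda>f'. state t f' N \<sigma> z (insert j D)
      (\<lambda>i. card (elders f' \<sigma> (insert j D) i) * (\<gamma> - 1))"])
qed

text \<open>Each cut moves one more index below \<open>N\<close> into \<open>D\<close>, so the
  iteration stops.\<close>

lemma cut_all:
  assumes "state t f N \<sigma> z D (\<lambda>i. card (elders f \<sigma> D i) * (\<gamma> - 1))" "t < n"
  shows "\<exists>f' D'. state t f' N \<sigma> z D' (\<lambda>i. card (elders f' \<sigma> D' i) * (\<gamma> - 1)) \<and>
    (\<forall>j<N. cell f' j \<inter> B t = {} \<longrightarrow> j \<in> D')"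
  using assms
proof (induction "card ({..<N} - D)" arbitrary: f D rule: less_induct)
  case less
  show ?case
  proof (cases "\<forall>j<N. cell f j \<inter> B t = {} \<longrightarrow> j \<in> D")
    case False
    then obtain j where j: "j < N" "j \<notin> D" "cell f j \<inter> B t = {}" by blast
    have "card ({..<N} - insert j D) < card ({..<N} - D)"
      using j by (intro psubset_card_mono) auto
    then show ?thesis using less.hyps cut[OF less.prems(1) j less.prems(2)] less.prems(2) by blast
  qed (use less.prems in blast)
qed

text \<open>By \<open>dead\<close>, every older cell that misses bag \<open>t\<close> has a filled
  buffer, so the free vertex \<open>x\<close> lies outside its reach; this is the buffer invariant
  for the new cell \<open>{x}\<close>. The second conclusion restores \<open>dead\<close> for the
  next creation.\<close>

lemma create:
  assumes st: "state t f N \<sigma> z D (\<lambda>i. card (elders f \<sigma> D i) * (\<gamma> - 1))" and t: "t < n"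
    and dead: "\<And>j. j < N \<Longrightarrow> cell f j \<inter> B t = {} \<Longrightarrow> j \<in> D"
    and x: "x \<in> B t" "f x = \<infinity>"
  defines "f' \<equiv> f(x := enat N)" and "\<sigma>' \<equiv> \<sigma>(N := t)" and "z' \<equiv> z(N := x)"
  shows "state t f' (Suc N) \<sigma>' z' D (\<lambda>i. card (elders f' \<sigma>' D i) * (\<gamma> - 1))"
    and "\<And>j. j < Suc N \<Longrightarrow> cell f' j \<inter> B t = {} \<Longrightarrow> j \<in> D"
proof -
  note D = stateD[OF st]
  have xV: "x \<in> V" using x t bags_V by blast
  have old: "cell f' i = cell f i" if "i < N" for i
    using that x unfolding cell_def f'_def by auto
  have "f v \<noteq> enat N" if "v \<in> V" for v using D(1)[OF that] by auto
  then have new: "cell f' N = {x}"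
    using xV unfolding cell_def f'_def by auto
  have keep: "f' v = f v" if "f v \<noteq> \<infinity>" for v using that x unfolding f'_def by auto
  have el: "elders f' \<sigma>' D i = elders f \<sigma> D i" if "i < N" for i
    using that D(9) old unfolding elders_def \<sigma>'_def by auto
  have reach: "reach f' j \<gamma> \<subseteq> reach f j \<gamma>" if "j < N" for j
    using grow_reach[of f f'] keep old[OF that] by blast
  show dead': "j \<in> D" if "j < Suc N" "cell f' j \<inter> B t = {}" for j
  proof (cases "j = N")
    case True
    then show ?thesis using that new x by simp
  qed (use that dead old in auto)
  show "state t f' (Suc N) \<sigma>' z' D (\<lambda>i. card (elders f' \<sigma>' D i) * (\<gamma> - 1))"
  proof (rule stateI)
    show "f' v = \<infinity> \<or> (\<exists>i<Suc N. f' v = enat i)" if "v \<in> V" for v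
      using D(1)[OF that] unfolding f'_def by (auto simp: less_Suc_eq)
    show "f' v \<noteq> \<infinity>" if "s < t" "v \<in> B s" for s v using D(2) keep that by metis
    show "\<sigma>' i \<le> t \<and> \<sigma>' i < n \<and> z' i \<in> B (\<sigma>' i) \<and> z' i \<in> cell f' i" if "i < Suc N" for i
      using D(3-6)[of i] old[of i] new t x that unfolding \<sigma>'_def z'_def by (auto simp: less_Suc_eq)
    show "(z' i, v) \<in> (Restr E (cell f' i))\<^sup>*" if "i < Suc N" "v \<in> cell f' i" for i v
      using D(7)[of i v] old[of i] new that unfolding z'_def by (auto simp: less_Suc_eq)
    show "\<exists>l\<le>card (elders f' \<sigma>' D i) * (\<gamma> - 1). (z' i, v) \<in> E ^^ l"
      if i: "i < Suc N" "v \<in> cell f' i" for i v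
      proof (cases "i = N")
        case True
        then have "(z' i, v) \<in> E ^^ 0" using i new unfolding z'_def by simp
        then show ?thesis by (intro exI[of _ 0]) simp
      next
        case False
        then show ?thesis using i D(8)[of i v] old el unfolding z'_def by simp
      qed
    show "j < Suc N" if "j \<in> D" for j using D(9)[OF that] by simp
    show "cell f' j \<inter> B s = {}" if "j \<in> D" "t \<le> s" "s < n" for j s
      using D(9,10)[of j] old that by simp
    show "f' v \<noteq> \<infinity>" if "j \<in> D" "v \<in> reach f' j \<gamma>" for j v
      using D(9,11)[of j] reach[of j] keep[of v] that by auto
    show "j \<in> D \<and> reach f' j \<gamma> \<inter> cell f' i = {}"
      if ij: "i < Suc N" "j < i" "cell f' j \<inter> B (\<sigma>' i) = {}" for i j
    proof (cases "i = N")
      case True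
      then have j: "j \<in> D" "j < N" using dead' ij unfolding \<sigma>'_def by auto
      have "x \<notin> reach f' j \<gamma>" using D(11)[OF j(1)] reach[OF j(2)] x by blast
      then show ?thesis using j new True by simp
    next
      case False
      then have i: "i < N" using ij by simp
      have e: "cell f j \<inter> B (\<sigma> i) = {}" using ij i old unfolding \<sigma>'_def by auto
      show ?thesis using D(12,13)[OF i ij(2) e] reach[of j] old[OF i] i ij(2) by auto
    qed
  qed
qed

text \<open>The number of free vertices in the finite bag \<open>t\<close> decreases with each
  creation.\<close>

lemma create_all:
  assumes "state t f N \<sigma> z D (\<lambda>i. card (elders f \<sigma> D i) * (\<gamma> - 1))" "t < n"
    and "\<forall>j<N. cell f j \<inter> B t = {} \<longrightarrow> j \<in> D"
  shows "\<exists>f' N' \<sigma>' z'. state t f' N' \<sigma>' z' D (\<lambda>i. card (elders f' \<sigma>' D i) * (\<gamma> - 1)) \<and>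
    (\<forall>v\<in>B t. f' v \<noteq> \<infinity>)"
  using assms
proof (induction "card {v \<in> B t. f v = \<infinity>}" arbitrary: f N \<sigma> z rule: less_induct)
  case less
  show ?case
  proof (cases "\<forall>v\<in>B t. f v \<noteq> \<infinity>")
    case False
    then obtain x where x: "x \<in> B t" "f x = \<infinity>" by blast
    have dead: "\<And>j. j < N \<Longrightarrow> cell f j \<inter> B t = {} \<Longrightarrow> j \<in> D" using less.prems by blast
    have "card {v \<in> B t. (f(x := enat N)) v = \<infinity>} < card {v \<in> B t. f v = \<infinity>}"
      using x bags_finite[OF less.prems(2)] by (intro psubset_card_mono) (auto split: if_splits)
    then show ?thesis
      using less.hyps create[OF less.prems(1,2) dead x] less.prems(2) by blast
  qed (use less.prems in blast)
qed

text \<open>For each bag, cutting comes first because \<open>create\<close> requires all cells that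
  miss the bag to be dead; creation then leaves no free vertex in it.\<close>

lemma state_exists:
  assumes "t \<le> n"
  shows "\<exists>f N \<sigma> z D. state t f N \<sigma> z D (\<lambda>i. card (elders f \<sigma> D i) * (\<gamma> - 1))"
  using assms
proof (induction t)
  case 0
  have "state 0 (\<lambda>_. \<infinity>) 0 \<sigma> z {} R" for \<sigma> z R by (rule stateI) auto
  then show ?case by blast
next
  case (Suc t)
  then obtain f N \<sigma> z D where
    "state t f N \<sigma> z D (\<lambda>i. card (elders f \<sigma> D i) * (\<gamma> - 1))" by auto
  then obtain f N \<sigma> z D where
    "state t f N \<sigma> z D (\<lambda>i. card (elders f \<sigma> D i) * (\<gamma> - 1))"
    "\<forall>j<N. cell f j \<inter> B t = {} \<longrightarrow> j \<in> D"
    using cut_all Suc.prems by (metis Suc_le_lessD)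
  then obtain f N \<sigma> z where
    st: "state t f N \<sigma> z D (\<lambda>i. card (elders f \<sigma> D i) * (\<gamma> - 1))" "\<forall>v\<in>B t. f v \<noteq> \<infinity>"
    using create_all Suc.prems by (metis Suc_le_lessD)
  have "state (Suc t) f N \<sigma> z D (\<lambda>i. card (elders f \<sigma> D i) * (\<gamma> - 1))"
  proof (rule stateI)
    note D = stateD[OF st(1)]
    show "f v \<noteq> \<infinity>" if "s < Suc t" "v \<in> B s" for s v
      using that D(2) st(2) by (metis less_SucE)
    show "\<sigma> i \<le> Suc t \<and> \<sigma> i < n \<and> z i \<in> B (\<sigma> i) \<and> z i \<in> cell f i" if "i < N" for i
      using D(3-6)[OF that] by simp
    show "cell f j \<inter> B s = {}" if "j \<in> D" "Suc t \<le> s" "s < n" for j s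
      using D(10) that by simp
    show "j \<in> D \<and> reach f j \<gamma> \<inter> cell f i = {}"
      if "i < N" "j < i" "cell f j \<inter> B (\<sigma> i) = {}" for i j
      using D(12,13)[OF that] by blast
  qed (rule stateD(1)[OF st(1)] stateD(7)[OF st(1)] stateD(8)[OF st(1)] stateD(9)[OF st(1)]
        stateD(11)[OF st(1)]; assumption)+
  then show ?case by blast
qed

text \<open>Reads off the state at \<open>t = n\<close>, where no vertex of \<open>V\<close> is
  free, so \<open>the_enat\<close> loses nothing there. The diameter bound is twice the radius
  bound. In the last property cell \<open>f u\<close> is the oldest on the path, which therefore
  runs in \<open>upward\<close>.\<close>

theorem buffered_cells:
  obtains f :: "'b \<Rightarrow> nat" and \<sigma> :: "nat \<Rightarrow> nat"
  where "\<And>v. v \<in> V \<Longrightarrow> \<sigma> (f v) < n"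
    and "\<And>a b c u v. \<lbrakk>a \<le> b; b \<le> c; c < n; u \<in> B a; v \<in> B c; f u = f v\<rbrakk> \<Longrightarrow> f u \<in> f ` B b"
    and "\<And>u v. \<lbrakk>u \<in> V; v \<in> V; f u = f v\<rbrakk> \<Longrightarrow> \<exists>l\<le>2 * k * (\<gamma> - 1). (u, v) \<in> E ^^ l"
    and "\<And>u v l. \<lbrakk>u \<in> V; l \<le> \<gamma>; (u, v) \<in> {(x, y) \<in> E. f u \<le> f x \<and> f u \<le> f y} ^^ l\<rbrakk>
           \<Longrightarrow> f u \<in> f ` B (\<sigma> (f v))"
proof -
  obtain g N \<sigma> z D where st: "state n g N \<sigma> z D (\<lambda>i. card (elders g \<sigma> D i) * (\<gamma> - 1))"
    using state_exists[of n] by auto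
  note D = stateD[OF st]
  define f where "f v = the_enat (g v)" for v
  have g: "g v = enat (f v) \<and> f v < N" if "v \<in> V" for v
  proof -
    have "g v \<noteq> \<infinity>" using that bags_V D(2) by blast
    then show ?thesis using D(1)[OF that] unfolding f_def by auto
  qed
  have cell: "v \<in> cell g i \<longleftrightarrow> v \<in> V \<and> f v = i" for v i
    using g unfolding cell_def by auto
  have BV: "B i \<subseteq> V" if "i < n" for i using that bags_V by blast
  have radius: "\<exists>l\<le>k * (\<gamma> - 1). (z (f v), v) \<in> E ^^ l" if v: "v \<in> V" for v
  proof -
    let ?i = "f v" and ?A = "elders g \<sigma> D (f v)"
    have i: "?i < N" using g v by blast
    \<comment> \<open>Each elder meets the starting bag in a vertex other than \<open>z ?i\<close>,
      which belongs to cell \<open>?i\<close> itself. This leaves at most \<open>k\<close> of the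
      \<open>k + 1\<close> vertices.\<close>
    have "?A \<subseteq> f ` (B (\<sigma> ?i) - {z ?i})"
    proof
      fix j assume j: "j \<in> ?A"
      then obtain w where w: "w \<in> cell g j" "w \<in> B (\<sigma> ?i)" "j < ?i" unfolding elders_def by blast
      then have "w \<noteq> z ?i" using D(6)[OF i] cell by auto
      then show "j \<in> f ` (B (\<sigma> ?i) - {z ?i})" using w cell by auto
    qed
    then have "card ?A \<le> card (B (\<sigma> ?i) - {z ?i})"
      using bags_finite[OF D(4)[OF i]] by (meson card_image_le card_mono finite_Diff finite_imageI le_trans)
    also have "\<dots> \<le> k" using bags_card[OF D(4)[OF i]] D(5)[OF i] by simp
    finally have "card ?A * (\<gamma> - 1) \<le> k * (\<gamma> - 1)" by simp
    moreover have "\<exists>l\<le>card ?A * (\<gamma> - 1). (z ?i, v) \<in> E ^^ l"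
      using D(8)[OF i, of v] cell[of v ?i] v by blast
    ultimately show ?thesis using le_trans by blast
  qed
  show thesis
  proof (rule that[of \<sigma> f])
    show "\<sigma> (f v) < n" if "v \<in> V" for v using D(4) g that by blast
    show "f u \<in> f ` B b"
      if h: "a \<le> b" "b \<le> c" "c < n" "u \<in> B a" "v \<in> B c" "f u = f v" for a b c u v
    proof -
      have uv: "u \<in> V" "v \<in> V" using h BV by (meson le_less_trans subsetD)+
      have "cell g (f u) \<inter> B b \<noteq> {}"
        using connected_convex[of "cell g (f u)" "z (f u)" u a v c b] D(7)[of "f u"] g uv h cell
        by auto
      then obtain w where "w \<in> B b" "f w = f u" using cell by auto
      then show ?thesis by (metis imageI)
    qed
    show "\<exists>l\<le>2 * k * (\<gamma> - 1). (u, v) \<in> E ^^ l" if h: "u \<in> V" "v \<in> V" "f u = f v" for u v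
    proof -
      obtain l l' where l: "l \<le> k * (\<gamma> - 1)" "(z (f u), u) \<in> E ^^ l"
        and l': "l' \<le> k * (\<gamma> - 1)" "(z (f u), v) \<in> E ^^ l'" using radius h by metis
      have "(u, v) \<in> E ^^ (l + l')"
        using sym_relpow[OF E_sym l(2)] l'(2) by (auto simp: relpow_add)
      moreover have "l + l' \<le> 2 * k * (\<gamma> - 1)" using l l' by simp
      ultimately show ?thesis by blast
    qed
    show "f u \<in> f ` B (\<sigma> (f v))"
      if h: "u \<in> V" "l \<le> \<gamma>" "(u, v) \<in> {(x, y) \<in> E. f u \<le> f x \<and> f u \<le> f y} ^^ l" for u v l
    proof -
      have v: "v \<in> V" "f u \<le> f v" using h E_V by (cases l; auto)+
      have "{(x, y) \<in> E. f u \<le> f x \<and> f u \<le> f y} \<subseteq> upward g (f u)"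
        using g E_V unfolding upward_def by auto
      then have "(u, v) \<in> upward g (f u) ^^ l" using h(3) by (rule relpow_mono)
      then have r: "v \<in> reach g (f u) \<gamma>" using h cell unfolding reach_def by blast
      have vN: "f v < N" using g v by blast
      have "cell g (f u) \<inter> B (\<sigma> (f v)) \<noteq> {}"
      proof (cases "f u = f v")
        case True
        then show ?thesis using D(5,6)[OF vN] by auto
      next
        case False
        then show ?thesis using D(13)[OF vN, of "f u"] r v cell by auto
      qed
      then obtain w where "w \<in> B (\<sigma> (f v))" "f w = f u" using cell by auto
      then show ?thesis by (metis imageI)
    qed
  qed
qed

end

section \<open>From graph distance to powers of the adjacency relation, and the coarsened
  cells\<close>

definition adj :: "'a ugraph \<Rightarrow> ('a \<times> 'a) set" where
  "adj G = {(u, v). {u, v} \<in> edges G}"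

lemma sym_adj: "sym (adj G)"
  by (auto simp: sym_def adj_def insert_commute)

lemma adj_verts: "simple_graph G \<Longrightarrow> adj G \<subseteq> verts G \<times> verts G"
  unfolding simple_graph_def adj_def by (fastforce simp: doubleton_eq_iff)

text \<open>Translates list walks into powers of \<open>adj G\<close>, which are easy to concatenate
  and reverse. Membership of \<open>u\<close> in \<open>verts G\<close> makes the one-vertex list a
  walk.\<close>

lemma gdist_le_iff:
  assumes G: "simple_graph G" and u: "u \<in> verts G"
  shows "gdist G u v \<le> enat m \<longleftrightarrow> (\<exists>l\<le>m. (u, v) \<in> adj G ^^ l)"
proof
  assume le: "gdist G u v \<le> enat m"
  let ?L = "(\<lambda>xs. enat (length xs - 1)) ` {xs. walk G u xs v}"
  have "?L \<noteq> {}"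
  proof
    assume "?L = {}"
    then have "gdist G u v = \<infinity>" unfolding gdist_def by (simp only: Inf_empty top_enat_def)
    with le show False by simp
  qed
  \<comment> \<open>A nonempty set of \<open>enat\<close> attains its infimum, so a shortest walk
    exists.\<close>
  then have "Inf ?L \<in> ?L" by (metis Inf_enat_def LeastI_ex ex_in_conv)
  then obtain xs where xs: "walk G u xs v" "length xs - 1 \<le> m"
    using le unfolding gdist_def by auto
  have "(u, v) \<in> adj G ^^ (length xs - 1)"
    unfolding relpow_fun_conv
    by (rule exI[of _ "(!) xs"]) (use xs(1) in \<open>auto simp: walk_def adj_def hd_conv_nth last_conv_nth\<close>)
  with xs(2) show "\<exists>l\<le>m. (u, v) \<in> adj G ^^ l" by blast
next
  assume "\<exists>l\<le>m. (u, v) \<in> adj G ^^ l"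
  then obtain l f where l: "l \<le> m" and f: "f 0 = u" "f l = v" "\<And>i. i < l \<Longrightarrow> (f i, f (Suc i)) \<in> adj G"
    unfolding relpow_fun_conv by blast
  have V: "f i \<in> verts G" if "i \<le> l" for i
  proof (cases i)
    case (Suc j)
    then show ?thesis using that f(3)[of j] adj_verts[OF G] by auto
  qed (use u f in simp)
  have "walk G u (map f [0..<Suc l]) v"
    unfolding walk_def
  proof (intro conjI allI impI)
    show "hd (map f [0..<Suc l]) = u" using f(1) by (simp add: hd_map del: upt_Suc)
    show "last (map f [0..<Suc l]) = v" using f(2) by simp
    show "set (map f [0..<Suc l]) \<subseteq> verts G" using V by auto
    show "{map f [0..<Suc l] ! i, map f [0..<Suc l] ! Suc i} \<in> edges G"
      if "Suc i < length (map f [0..<Suc l])" for i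
      using that f(3)[of i] unfolding adj_def by (simp del: upt_Suc)
  qed simp
  then have "gdist G u v \<le> enat (length (map f [0..<Suc l]) - 1)"
    unfolding gdist_def by (intro INF_lower) simp
  then show "gdist G u v \<le> enat m" using l by (simp add: order_trans)
qed

lemma path_decomposition_bag_sequence:
  assumes "simple_graph H" "path_decomposition H Bs" "0 < \<gamma>"
    and "\<forall>B\<in>set Bs. finite B \<and> card B \<le> k + 1"
  shows "bag_sequence (verts H) (adj H) ((!) Bs) (length Bs) k \<gamma>"
proof
  show "sym (adj H)" "adj H \<subseteq> verts H \<times> verts H" using sym_adj adj_verts assms(1) by blast+
  show "(\<Union>i<length Bs. Bs ! i) = verts H"
  proof -
    have "(\<Union>i<length Bs. Bs ! i) = \<Union>(set Bs)" by (auto simp: set_conv_nth)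
    then show ?thesis using assms(2) unfolding path_decomposition_def by simp
  qed
  show "\<exists>i<length Bs. u \<in> Bs ! i \<and> v \<in> Bs ! i" if "(u, v) \<in> adj H" for u v
  proof -
    have "{u, v} \<in> edges H" using that unfolding adj_def by simp
    then obtain B where "B \<in> set Bs" "{u, v} \<subseteq> B"
      using assms(2) unfolding path_decomposition_def by meson
    then show ?thesis by (auto simp: in_set_conv_nth)
  qed
  show "v \<in> Bs ! b" if "a \<le> b" "b \<le> c" "c < length Bs" "v \<in> Bs ! a" "v \<in> Bs ! c" for a b c v
  proof -
    have "Bs ! a \<inter> Bs ! c \<subseteq> Bs ! b" using assms(2) that(1-3) unfolding path_decomposition_def by simp
    then show ?thesis using that(4,5) by blast
  qed
qed (use assms(3,4) in auto)

text \<open>The part of \<open>v\<close> is the oldest cell that meets the ball of radius \<open>\<rho>\<close> around \<open>v\<close>. If two such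
  balls meet in a vertex of the cell \<open>i\<close>, then by the buffer property of the cells both parts
  meet the bag \<open>\<sigma> i\<close> in which \<open>i\<close> was created.\<close>

lemma (in bag_sequence) coarsening:
  assumes \<gamma>: "\<gamma> = 2 * \<rho>"
  obtains h :: "'b \<Rightarrow> nat" and f :: "'b \<Rightarrow> nat"
  where "\<And>v. v \<in> V \<Longrightarrow> h v \<in> f ` V"
    and "\<And>a b c u v. \<lbrakk>a \<le> b; b \<le> c; c < n; u \<in> B a; v \<in> B c; f u = f v\<rbrakk> \<Longrightarrow> f u \<in> f ` B b"
    and "\<And>u v l. \<lbrakk>u \<in> V; l \<le> \<gamma>; (u, v) \<in> E ^^ l\<rbrakk> \<Longrightarrow> \<exists>s<n. h u \<in> f ` B s \<and> h v \<in> f ` B s"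
    and "\<And>u v. \<lbrakk>u \<in> V; v \<in> V; h u = h v\<rbrakk> \<Longrightarrow> \<exists>l\<le>2 * k * (\<gamma> - 1) + \<gamma>. (u, v) \<in> E ^^ l"
proof -
  obtain f :: "'b \<Rightarrow> nat" and \<sigma> where \<sigma>: "\<And>v. v \<in> V \<Longrightarrow> \<sigma> (f v) < n"
    and convex: "\<And>a b c u v. \<lbrakk>a \<le> b; b \<le> c; c < n; u \<in> B a; v \<in> B c; f u = f v\<rbrakk> \<Longrightarrow> f u \<in> f ` B b"
    and diam: "\<And>u v. \<lbrakk>u \<in> V; v \<in> V; f u = f v\<rbrakk> \<Longrightarrow> \<exists>l\<le>2 * k * (\<gamma> - 1). (u, v) \<in> E ^^ l"
    and buffer: "\<And>u v l. \<lbrakk>u \<in> V; l \<le> \<gamma>; (u, v) \<in> {(x, y) \<in> E. f u \<le> f x \<and> f u \<le> f y} ^^ l\<rbrakk>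
           \<Longrightarrow> f u \<in> f ` B (\<sigma> (f v))"
    by (rule buffered_cells) blast
  have V: "v \<in> V" if "u \<in> V" "(u, v) \<in> E ^^ l" for u v l
    using that E_V by (cases l) auto
  define ball where "ball v = {w. \<exists>l\<le>\<rho>. (v, w) \<in> E ^^ l}" for v
  have self: "v \<in> ball v" for v unfolding ball_def by (auto intro: exI[of _ 0])
  have ball_V: "ball v \<subseteq> V" if "v \<in> V" for v using that V unfolding ball_def by blast
  define h where "h v = (LEAST i. i \<in> f ` ball v)" for v
  have h: "h v \<in> f ` ball v" for v
    unfolding h_def by (rule LeastI[of _ "f v"]) (use self in blast)
  have h_le: "h v \<le> f w" if "w \<in> ball v" for v w
    unfolding h_def by (rule Least_le) (use that in blast)
  \<comment> \<open>A path of length at most \<open>\<rho>\<close> from \<open>v\<close> stays in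
    the ball of \<open>v\<close>, where no cell is older than \<open>h v\<close>.\<close>
  have geodesic: "(v, w) \<in> {(x, y) \<in> E. h v \<le> f x \<and> h v \<le> f y} ^^ l"
    if "(v, w) \<in> E ^^ l" "l \<le> \<rho>" for v w l
    using that
  proof (induction l arbitrary: w)
    case (Suc l)
    then obtain x where x: "(v, x) \<in> E ^^ l" "(x, w) \<in> E" by auto
    have "x \<in> ball v" using x(1) Suc_leD[OF Suc.prems(2)] unfolding ball_def by blast
    moreover have "w \<in> ball v" using Suc.prems unfolding ball_def by blast
    moreover have "(v, x) \<in> {(x, y) \<in> E. h v \<le> f x \<and> h v \<le> f y} ^^ l"
      using Suc.IH x(1) Suc_leD[OF Suc.prems(2)] by blast
    ultimately show ?case using x(2) h_le by auto
  qed simp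
  \<comment> \<open>Take \<open>w\<close> in the ball with \<open>f w = h v\<close>. The path from
    \<open>w\<close> through \<open>v\<close> to \<open>m\<close> has length at most
    \<open>2 * \<rho>\<close>, and cell \<open>f w\<close> is the oldest on it, so
    \<open>buffer\<close> applies.\<close>
  have meet: "h v \<in> f ` B (\<sigma> (f m))" if v: "v \<in> V" "m \<in> ball v" for v m
  proof -
    let ?R = "{(x, y) \<in> E. h v \<le> f x \<and> h v \<le> f y}"
    obtain w where w: "w \<in> ball v" "h v = f w" using h by blast
    obtain i j where ij: "i \<le> \<rho>" "(v, w) \<in> E ^^ i" "j \<le> \<rho>" "(v, m) \<in> E ^^ j"
      using w(1) v(2) unfolding ball_def by blast
    have "sym ?R" using E_sym by (auto simp: sym_def)
    then have "(w, v) \<in> ?R ^^ i" using geodesic[OF ij(2,1)] by (rule sym_relpow)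
    then have "(w, m) \<in> ?R ^^ (i + j)" using geodesic[OF ij(4,3)] by (auto simp: relpow_add)
    moreover have "w \<in> V" "i + j \<le> \<gamma>" using w(1) ball_V v ij \<gamma> by auto
    ultimately show ?thesis using buffer[of w "i + j" m] w(2) by simp
  qed
  show thesis
  proof (rule that[of h f])
    show "h v \<in> f ` V" if "v \<in> V" for v using h ball_V that by blast
    show "f u \<in> f ` B b" if "a \<le> b" "b \<le> c" "c < n" "u \<in> B a" "v \<in> B c" "f u = f v"
      for a b c u v using convex that .
    show "\<exists>s<n. h u \<in> f ` B s \<and> h v \<in> f ` B s" if l: "u \<in> V" "l \<le> \<gamma>" "(u, v) \<in> E ^^ l" for u v l
    proof -
      \<comment> \<open>Splitting the path near its middle gives a vertex \<open>m\<close> in both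
        balls; the common bag is \<open>\<sigma> (f m)\<close>.\<close>
      have "\<exists>i j. i \<le> \<rho> \<and> j \<le> \<rho> \<and> l = i + j"
        using l(2) \<gamma> by (intro exI[of _ "min l \<rho>"] exI[of _ "l - \<rho>"]) auto
      then obtain i j where ij: "i \<le> \<rho>" "j \<le> \<rho>" "l = i + j" by blast
      then obtain m where m: "(u, m) \<in> E ^^ i" "(m, v) \<in> E ^^ j"
        using l(3) by (auto simp: relpow_add)
      have "m \<in> ball u" "m \<in> ball v"
        using m ij sym_relpow[OF E_sym] unfolding ball_def by blast+
      then show ?thesis using meet[of u m] meet[of v m] \<sigma>[of m] V l(1,3) ball_V by blast
    qed
    show "\<exists>l\<le>2 * k * (\<gamma> - 1) + \<gamma>. (u, v) \<in> E ^^ l" if uv: "u \<in> V" "v \<in> V" "h u = h v" for u v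
    proof -
      obtain x y where xy: "x \<in> ball u" "h u = f x" "y \<in> ball v" "h v = f y" using h by blast
      obtain i j where ij: "i \<le> \<rho>" "(u, x) \<in> E ^^ i" "j \<le> \<rho>" "(v, y) \<in> E ^^ j"
        using xy unfolding ball_def by blast
      obtain l where l: "l \<le> 2 * k * (\<gamma> - 1)" "(x, y) \<in> E ^^ l"
        using diam[of x y] xy uv ball_V by auto
      have "(u, v) \<in> E ^^ (i + l + j)"
        using ij(2) l(2) sym_relpow[OF E_sym ij(4)] by (auto simp: relpow_add)
      moreover have "i + l + j \<le> 2 * k * (\<gamma> - 1) + \<gamma>" using ij l \<gamma> by simp
      ultimately show ?thesis by blast
    qed
  qed
qed

section \<open>Pulling the partition back along the quasi-isometry\<close>

theorem theorem3:
  fixes c :: real and k :: nat and G :: "'a ugraph" and H :: "'b ugraph"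
  assumes "c \<ge> 1"
    and "simple_graph G" and "simple_graph H"
    and "quasi_isometric c G H"
    and "pathwidth H \<le> enat k"
  shows "\<exists>\<P>. partition_on (verts G) \<P> \<and>
             pathwidth (quotient_graph G \<P>) \<le> enat k \<and>
             (\<forall>P\<in>\<P>. ereal_of_enat (weak_diameter G P) \<le> ereal (4 * (real k + 1) * c\<^sup>2 + c))"
proof -
  obtain \<phi> where \<phi>: "quasi_isometry c G H \<phi>" using assms(4) unfolding quasi_isometric_def by blast
  have \<phi>V: "\<phi> g \<in> verts H" if "g \<in> verts G" for g
    using \<phi> that unfolding quasi_isometry_def by blast
  obtain Bs where Bs: "path_decomposition H Bs" "\<forall>B\<in>set Bs. finite B \<and> card B \<le> k + 1"
    using assms(5) unfolding pathwidth_le_iff by blast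
  \<comment> \<open>Images of adjacent vertices are at distance at most \<open>c * 1 + c\<close>,
    and distances are integers. Then \<open>2 * \<rho>\<close> is \<open>r\<close> rounded up to an
    even number, so \<open>2 * \<rho> - 1 \<le> r\<close>.\<close>
  define r where "r = nat \<lfloor>2 * c\<rfloor>"
  define \<rho> where "\<rho> = (r + 1) div 2"
  have r: "real r \<le> 2 * c" "2 * c < real r + 1" using assms(1) unfolding r_def by linarith+
  have \<rho>: "r \<le> 2 * \<rho>" "2 * \<rho> \<le> r + 1" unfolding \<rho>_def by linarith+
  have "0 < 2 * \<rho>" using r(2) assms(1) \<rho>(1) by linarith
  then interpret bag_sequence "verts H" "adj H" "(!) Bs" "length Bs" k "2 * \<rho>"
    using path_decomposition_bag_sequence assms(3) Bs by blast
  obtain h f :: "'b \<Rightarrow> nat" where h_in: "\<And>v. v \<in> verts H \<Longrightarrow> h v \<in> f ` verts H"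
    and convex: "\<And>a b c u v. \<lbrakk>a \<le> b; b \<le> c; c < length Bs; u \<in> Bs ! a; v \<in> Bs ! c; f u = f v\<rbrakk>
      \<Longrightarrow> f u \<in> f ` (Bs ! b)"
    and near: "\<And>u v l. \<lbrakk>u \<in> verts H; l \<le> 2 * \<rho>; (u, v) \<in> adj H ^^ l\<rbrakk>
      \<Longrightarrow> \<exists>s<length Bs. h u \<in> f ` (Bs ! s) \<and> h v \<in> f ` (Bs ! s)"
    and diam: "\<And>u v. \<lbrakk>u \<in> verts H; v \<in> verts H; h u = h v\<rbrakk>
      \<Longrightarrow> \<exists>l\<le>2 * k * (2 * \<rho> - 1) + 2 * \<rho>. (u, v) \<in> adj H ^^ l"
    by (rule coarsening[OF refl]) blast
  define part where "part i = {g \<in> verts G. h (\<phi> g) = i}" for i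
  \<comment> \<open>Only labels that occur are kept, which makes all parts nonempty and
    \<open>part\<close> injective on \<open>I\<close>.\<close>
  define I where "I = (\<lambda>g. h (\<phi> g)) ` verts G"
  have part_eq: "i = j" if "i \<in> I" "part i = part j" for i j
    using that unfolding I_def part_def by blast
  have "partition_on (verts G) (part ` I)"
  proof (rule partition_onI)
    show "disjnt p q" if "p \<in> part ` I" "q \<in> part ` I" "p \<noteq> q" for p q
      using that unfolding part_def disjnt_def by auto
  qed (auto simp: part_def I_def)
  moreover have "pathwidth (quotient_graph G (part ` I)) \<le> enat k"
    unfolding pathwidth_le_iff
  proof (intro exI conjI)
    \<comment> \<open>A part is placed wherever the cell that labels it meets the bag, even if its
      own vertices are mapped elsewhere. Each vertex of a bag contributes at most one part, so the
      width does not increase.\<close>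
    let ?Bs = "map (\<lambda>B. part ` (f ` B \<inter> I)) Bs"
    show "path_decomposition (quotient_graph G (part ` I)) ?Bs"
      unfolding path_decomposition_def
    proof (intro conjI ballI allI impI)
      show "?Bs \<noteq> []" using Bs(1) unfolding path_decomposition_def by simp
      have "I \<subseteq> f ` verts H" using h_in \<phi>V unfolding I_def by blast
      moreover have "verts H = \<Union> (set Bs)" using Bs(1) unfolding path_decomposition_def by simp
      ultimately have "(\<Union>B\<in>set Bs. f ` B \<inter> I) = I" by (auto simp: image_Union)
      then have "(\<Union>B\<in>set Bs. part ` (f ` B \<inter> I)) = part ` I" by (metis image_UN)
      then show "\<Union> (set ?Bs) = verts (quotient_graph G (part ` I))"
        unfolding quotient_graph_def by simp
    next
      fix e assume "e \<in> edges (quotient_graph G (part ` I))"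
      then have "\<exists>p q. e = {p, q} \<and> p \<in> part ` I \<and> q \<in> part ` I \<and> p \<noteq> q \<and>
          (\<exists>u\<in>p. \<exists>v\<in>q. {u, v} \<in> edges G)"
        unfolding quotient_graph_def by (simp only: ugraph.simps mem_Collect_eq)
      then obtain p q u v where pq: "e = {p, q}" "p \<in> part ` I" "q \<in> part ` I" "p \<noteq> q"
        "u \<in> p" "v \<in> q" "{u, v} \<in> edges G"
        by (elim exE conjE bexE)
      then obtain i j where ij: "p = part i" "q = part j" "i \<in> I" "j \<in> I" by blast
      note e = pq[unfolded ij(1,2)] ij(3,4)
      have uv: "u \<in> verts G" "v \<in> verts G" "h (\<phi> u) = i" "h (\<phi> v) = j" "u \<noteq> v"
        using e unfolding part_def by auto
      have "(u, v) \<in> adj G ^^ 1" using e(7) by (simp add: adj_def)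
      then have "gdist G u v \<le> enat 1" using gdist_le_iff[OF assms(2) uv(1)] by blast
      then have "ereal_of_enat (gdist G u v) \<le> 1"
        by (metis ereal_of_enat_le_iff ereal_of_enat_simps(1) of_nat_1 one_ereal_def)
      then have "ereal c * ereal_of_enat (gdist G u v) + ereal c \<le> ereal c * 1 + ereal c"
        using assms(1) by (intro add_right_mono ereal_mult_left_mono) auto
      moreover have "ereal_of_enat (gdist H (\<phi> u) (\<phi> v))
          \<le> ereal c * ereal_of_enat (gdist G u v) + ereal c"
        using \<phi> uv unfolding quasi_isometry_def by blast
      ultimately have le: "ereal_of_enat (gdist H (\<phi> u) (\<phi> v)) \<le> ereal (2 * c)"
        by (auto intro: order_trans)
      then obtain d where d: "gdist H (\<phi> u) (\<phi> v) = enat d"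
        by (cases "gdist H (\<phi> u) (\<phi> v)") auto
      have "d \<le> r" using le d r(2) by simp
      then have "gdist H (\<phi> u) (\<phi> v) \<le> enat (2 * \<rho>)" using d \<rho>(1) by simp
      then obtain s where s: "s < length Bs" "i \<in> f ` (Bs ! s)" "j \<in> f ` (Bs ! s)"
        using gdist_le_iff[OF assms(3) \<phi>V] near \<phi>V uv by metis
      then have "e \<subseteq> ?Bs ! s" using e by auto
      then show "\<exists>B\<in>set ?Bs. e \<subseteq> B" using s(1) by (metis length_map nth_mem)
    next
      fix i j l assume ijl: "i \<le> j \<and> j \<le> l \<and> l < length ?Bs"
      show "?Bs ! i \<inter> ?Bs ! l \<subseteq> ?Bs ! j"
      proof
        fix p assume "p \<in> ?Bs ! i \<inter> ?Bs ! l"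
        then obtain a b where ab: "p = part a" "p = part b" "a \<in> I" "a \<in> f ` (Bs ! i)" "b \<in> f ` (Bs ! l)"
          using ijl by auto
        then have "a = b" using part_eq by blast
        then have "a \<in> f ` (Bs ! j)" using convex[of i j l] ab ijl by auto
        then show "p \<in> ?Bs ! j" using ab ijl by auto
      qed
    qed
    show "\<forall>B\<in>set ?Bs. finite B \<and> card B \<le> k + 1"
    proof
      fix B' assume "B' \<in> set ?Bs"
      then obtain B where B: "B \<in> set Bs" "B' = part ` (f ` B \<inter> I)" by auto
      then have fin: "finite B" "card B \<le> k + 1" using Bs(2) by blast+
      have "card B' \<le> card (f ` B \<inter> I)" unfolding B(2) using fin by (intro card_image_le) auto
      also have "\<dots> \<le> card (f ` B)" using fin by (intro card_mono) auto
      also have "\<dots> \<le> card B" using fin by (intro card_image_le) auto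
      finally show "finite B' \<and> card B' \<le> k + 1" using fin B by auto
    qed
  qed
  moreover have "ereal_of_enat (weak_diameter G P) \<le> ereal (4 * (real k + 1) * c\<^sup>2 + c)"
    if P: "P \<in> part ` I" for P
  proof -
    let ?D = "4 * (real k + 1) * c\<^sup>2 + c"
    have D0: "0 \<le> ?D" using assms(1) by simp
    have "ereal_of_enat (gdist G u v) \<le> ereal ?D" if uv: "u \<in> P" "v \<in> P" for u v
    proof (cases "u = v")
      \<comment> \<open>The quasi-isometry inequalities speak of distinct vertices only.\<close>
      case True
      have "u \<in> verts G" using uv P unfolding part_def by auto
      moreover have "(u, v) \<in> adj G ^^ 0" using True by simp
      ultimately have "gdist G u v \<le> enat 0" using gdist_le_iff[OF assms(2)] by blast
      then show ?thesis using D0 by (simp add: enat_0)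
    next
      case False
      have V: "u \<in> verts G" "v \<in> verts G" "h (\<phi> u) = h (\<phi> v)" using uv P unfolding part_def by auto
      obtain l where l: "l \<le> 2 * k * (2 * \<rho> - 1) + 2 * \<rho>" "(\<phi> u, \<phi> v) \<in> adj H ^^ l"
        using diam[of "\<phi> u" "\<phi> v"] \<phi>V V by blast
      have "2 * \<rho> - 1 \<le> r" using \<rho>(2) by simp
      then have "2 * k * (2 * \<rho> - 1) \<le> 2 * k * r" by (rule mult_le_mono2)
      then have "l \<le> 2 * k * r + r + 1" using l(1) \<rho>(2) by linarith
      then have "real l \<le> 2 * real k * real r + real r + 1"
        by (metis (mono_tags, lifting) of_nat_1 of_nat_add of_nat_le_iff of_nat_mult of_nat_numeral)
      \<comment> \<open>Uses \<open>r \<le> 2 * c\<close> twice and \<open>1 \<le> 2 * c\<close> for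
        the rounding; the sum is \<open>4 * (k + 1) * c\<close>.\<close>
      also have "\<dots> \<le> 2 * real k * (2 * c) + 2 * c + 2 * c"
        using r(1) assms(1) by (intro add_mono mult_left_mono) auto
      finally have lc: "real l \<le> 4 * (real k + 1) * c" by (simp add: algebra_simps)
      have "gdist H (\<phi> u) (\<phi> v) \<le> enat l"
        using gdist_le_iff[OF assms(3) \<phi>V[OF V(1)]] l(2) by blast
      then have "ereal_of_enat (gdist H (\<phi> u) (\<phi> v)) \<le> ereal (real l)"
        by (metis ereal_of_enat_le_iff ereal_of_enat_simps(1))
      then have "ereal c * ereal_of_enat (gdist H (\<phi> u) (\<phi> v)) + ereal c
          \<le> ereal c * ereal (real l) + ereal c"
        using assms(1) by (intro add_right_mono ereal_mult_left_mono) auto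
      moreover have "ereal_of_enat (gdist G u v)
          \<le> ereal c * ereal_of_enat (gdist H (\<phi> u) (\<phi> v)) + ereal c"
        using \<phi> V False unfolding quasi_isometry_def by blast
      ultimately have "ereal_of_enat (gdist G u v) \<le> ereal (c * real l + c)"
        by (auto intro: order_trans)
      also have "c * real l + c \<le> ?D"
        using mult_left_mono[OF lc, of c] assms(1) by (simp add: power2_eq_square algebra_simps)
      finally show ?thesis by simp
    qed
    note le = this
    \<comment> \<open>The supremum in \<open>weak_diameter\<close> is taken in \<open>enat\<close>,
      so the real bound is rounded down first.\<close>
    have "gdist G u v \<le> enat (nat \<lfloor>?D\<rfloor>)" if "u \<in> P" "v \<in> P" for u v
    proof (cases "gdist G u v")
      case (enat d)
      then have "real d \<le> ?D" using le[OF that] by simp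
      then show ?thesis using enat by (simp only: enat_ord_simps le_nat_floor)
    qed (use le[OF that] in simp)
    then have "weak_diameter G P \<le> enat (nat \<lfloor>?D\<rfloor>)"
      unfolding weak_diameter_def by (intro SUP_least)
    then have "ereal_of_enat (weak_diameter G P) \<le> ereal (real (nat \<lfloor>?D\<rfloor>))"
      by (metis ereal_of_enat_le_iff ereal_of_enat_simps(1))
    also have "\<dots> \<le> ereal ?D" using D0 by simp
    finally show ?thesis .
  qed
  ultimately show ?thesis by blast
qed

end
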